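(* Let $r\geq 2$ be an integer. If $r\equiv 1\pmod 4$ and there exists a finite projective plane of order $r$, then there exists an $(r,r+1;6)$-babi-graph of order $2r^2+r+1$.
   Context: Graphs are finite and simple. The girth of a graph is the length of its shortest cycle; the order of a graph is its number of vertices. For integers $1\leq r\leq s$ and $g\geq 3$, an $(r,s;g)$-balanced biregular graph (for short, $(r,s;g)$-babi-graph) is a graph of girth $g$ whose set of vertex degrees equals $\{r,s\}$ and in which the number of vertices of degree $r$ equals the number of vertices of degree $s$. A finite projective plane of order $q$ ($q\geq 2$) is an incidence structure with $q^2+q+1$ points and $q^2+q+1$ lines such that any two distinct points are incident with precisely one common line, any two distinct lines are incident with precisely one common point, each line is incident with exactly $q+1$ points, and each point is incident with exactly $q+1$ lines. *)

theory Defs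
  imports
    "Graph_Theory.Pair_Digraph"
    "HOL-Library.Extended_Nat"
    "HOL-Number_Theory.Cong"
begin

text \<open>
  Finite simple graphs are represented by \<^locale>\<open>pair_graph\<close>: a finite vertex set with a
  symmetric irreflexive set of ordered pairs, so that every edge \<open>{u, v}\<close> contributes the two
  arcs \<open>(u, v)\<close> and \<open>(v, u)\<close>.  The degree of a vertex is then its out-degree.
\<close>

abbreviation graph_degree :: "'a pair_pre_digraph \<Rightarrow> 'a \<Rightarrow> nat" where
  "graph_degree G v \<equiv> out_degree (with_proj G) v"

text \<open>
  For symmetric digraphs \<^const>\<open>pre_digraph.cycle\<close> also admits the degenerate closed walks
  \<open>u, v, u\<close>, which are not cycles of the undirected graph; the bound on the length excludes
  exactly these.  The girth of an acyclic graph is \<open>\<infinity>\<close>.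
\<close>

definition graph_cycle :: "'a pair_pre_digraph \<Rightarrow> ('a \<times> 'a) list \<Rightarrow> bool" where
  "graph_cycle G p \<longleftrightarrow> pre_digraph.cycle (with_proj G) p \<and> 3 \<le> length p"

definition girth :: "'a pair_pre_digraph \<Rightarrow> enat" where
  "girth G = (INF p \<in> {p. graph_cycle G p}. enat (length p))"

locale babi_graph = pair_graph G
  for r s g :: nat and G :: "'a pair_pre_digraph" +
  assumes parameters: "1 \<le> r" "r \<le> s" "3 \<le> g"
    and girth_eq: "girth G = enat g"
    and degree_set: "graph_degree G ` pverts G = {r, s}"
    and balanced: "card {v \<in> pverts G. graph_degree G v = r} =
      card {v \<in> pverts G. graph_degree G v = s}"

locale projective_plane =
  fixes Points :: "'p set" and Lines :: "'l set" and incident :: "'p \<Rightarrow> 'l \<Rightarrow> bool" and q :: nat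
  assumes order_ge_2: "2 \<le> q"
    and card_Points: "card Points = q\<^sup>2 + q + 1"
    and card_Lines: "card Lines = q\<^sup>2 + q + 1"
    and common_line: "\<And>x y. x \<in> Points \<Longrightarrow> y \<in> Points \<Longrightarrow> x \<noteq> y \<Longrightarrow>
      \<exists>!l. l \<in> Lines \<and> incident x l \<and> incident y l"
    and common_point: "\<And>l m. l \<in> Lines \<Longrightarrow> m \<in> Lines \<Longrightarrow> l \<noteq> m \<Longrightarrow>
      \<exists>!x. x \<in> Points \<and> incident x l \<and> incident x m"
    and points_on_line: "\<And>l. l \<in> Lines \<Longrightarrow> card {x \<in> Points. incident x l} = q + 1"
    and lines_through_point: "\<And>x. x \<in> Points \<Longrightarrow> card {l \<in> Lines. incident x l} = q + 1"

end

theory Submission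
  imports Defs
begin

text \<open>
  The incidence graph of a projective plane of order \<open>r\<close> is \<open>(r + 1)\<close>-regular on
  \<open>2 r\<^sup>2 + 2 r + 2\<close> vertices, and it has no 4-cycle because two points lie on only one common
  line.  Any subgraph inherits bipartiteness and the absence of 4-cycles, so its girth is at least 6.
  It is therefore enough to remove \<open>r + 1\<close> vertices and some edges so that no vertex loses more
  than one edge, exactly half of the vertices lose one, and some triangle of the plane survives.

  The vertices removed are a line, written \<open>infinity\<close>, together with all of its points but one,
  \<open>z\<close>.  Every line other than \<open>infinity\<close> meets it in exactly one point, so the \<open>r\<^sup>2\<close> lines
  that avoid \<open>z\<close> lose one point each, while the \<open>r\<close> remaining lines through \<open>z\<close> lose none.
  Among the points, \<open>z\<close> loses a line and the \<open>r\<^sup>2\<close> affine points lose none.  Thus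
  \<open>r\<^sup>2 + 1\<close> vertices now have degree \<open>r\<close> and the other \<open>r\<^sup>2 + r\<close> have degree \<open>r + 1\<close>.

  Next choose \<open>k\<close> of the lines through \<open>z\<close> and delete one flag on each, at an affine point.
  These \<open>k\<close> edges form a matching among vertices of degree \<open>r + 1\<close>, because two lines through
  \<open>z\<close> share no affine point.  The numbers of vertices of degree \<open>r\<close> and \<open>r + 1\<close> become
  \<open>r\<^sup>2 + 1 + 2 k\<close> and \<open>r\<^sup>2 + r - 2 k\<close>, which agree exactly if \<open>r = 4 k + 1\<close>; this is where
  the congruence comes from.  A triangle with corner \<open>z\<close> and two sides among the
  \<open>r - k\<close> untouched lines through \<open>z\<close> gives a 6-cycle.  The degree count is in
  \<open>degree_graph\<close> and \<open>card_low_degree\<close>, the girth in \<open>girth_graph\<close>.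
\<close>

section \<open>Incidence graphs and their girth\<close>

definition incidence_graph ::
  "'a set \<Rightarrow> 'a set \<Rightarrow> ('a \<Rightarrow> 'a \<Rightarrow> bool) \<Rightarrow> 'a pair_pre_digraph" where
  "incidence_graph P L I = \<lparr>pverts = P \<union> L,
     parcs = {(x, l). x \<in> P \<and> l \<in> L \<and> I x l} \<union> {(l, x). x \<in> P \<and> l \<in> L \<and> I x l}\<rparr>"

lemma pverts_incidence_graph [simp]: "pverts (incidence_graph P L I) = P \<union> L"
  by (simp add: incidence_graph_def)

lemma in_parcs_incidence_graph:
  "(u, v) \<in> parcs (incidence_graph P L I) \<longleftrightarrow>
     u \<in> P \<and> v \<in> L \<and> I u v \<or> v \<in> P \<and> u \<in> L \<and> I v u"
  by (auto simp: incidence_graph_def)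

lemma pair_graph_incidence_graph:
  assumes "finite P" "finite L" "P \<inter> L = {}"
  shows "pair_graph (incidence_graph P L I)"
proof -
  have "parcs (incidence_graph P L I) \<subseteq> (P \<union> L) \<times> (P \<union> L)"
    by (auto simp: incidence_graph_def)
  then have fin: "finite (parcs (incidence_graph P L I))"
    using assms finite_subset by blast
  show ?thesis
    using assms fin
    by unfold_locales
      (auto simp: in_parcs_incidence_graph symmetric_def intro!: symI)
qed

lemma graph_degree_eq_card_neighbours:
  "graph_degree G v = card {w. (v, w) \<in> parcs G}"
proof -
  have "out_arcs (with_proj G) v = Pair v ` {w. (v, w) \<in> parcs G}"
    by (auto simp: out_arcs_def)
  then show ?thesis
    by (simp add: out_degree_def card_image inj_on_def)
qed

lemma graph_degree_incidence_graph:
  assumes "P \<inter> L = {}"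
  shows "x \<in> P \<Longrightarrow> graph_degree (incidence_graph P L I) x = card {l \<in> L. I x l}"
    and "l \<in> L \<Longrightarrow> graph_degree (incidence_graph P L I) l = card {x \<in> P. I x l}"
  unfolding graph_degree_eq_card_neighbours in_parcs_incidence_graph
  using assms by (auto intro!: arg_cong[where f = card])

text \<open>
  Reading the visited vertices directly off the arcs makes the distinctness condition independent
  of the start vertex, so that it can be computed for an explicit list of arcs.
\<close>

lemma graph_cycle_iff:
  "graph_cycle G p \<longleftrightarrow> (\<exists>u. u \<in> pverts G \<and> set p \<subseteq> parcs G \<and> pcas u p u) \<and>
     distinct (tl (map fst p @ [snd (last p)])) \<and> 3 \<le> length p"
proof -
  have verts: "pawalk_verts u p = map fst p @ [snd (last p)]" if "p \<noteq> []" for u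
    using that by (induction p arbitrary: u) auto
  show ?thesis
    unfolding graph_cycle_def pre_digraph.cycle_def pre_digraph.awalk_def
      cas_with_proj_eq awalk_verts_with_proj_eq
    using verts by (cases "p = []") auto
qed

text \<open>Every arc changes sides, so a closed walk has even length.\<close>

lemma walk_parity:
  assumes "P \<inter> L = {}" "pcas u p v" "set p \<subseteq> parcs (incidence_graph P L I)" "u \<in> P \<union> L"
  shows "(u \<in> P \<longleftrightarrow> v \<in> P) \<longleftrightarrow> even (length p)"
  using assms(2-4)
proof (induction p arbitrary: u)
  case (Cons e p)
  obtain w where e: "e = (u, w)" using Cons.prems by (cases e) auto
  then have "w \<in> P \<union> L" "u \<in> P \<longleftrightarrow> w \<notin> P"
    using Cons.prems assms(1) by (auto simp: in_parcs_incidence_graph)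
  with Cons e show ?case by auto
qed simp

lemma graph_cycle_length_4:
  assumes "graph_cycle G p" "length p = 4"
  obtains u v w x where "(u, v) \<in> parcs G" "(v, w) \<in> parcs G" "(w, x) \<in> parcs G"
    "(x, u) \<in> parcs G" "u \<noteq> w" "v \<noteq> x"
proof -
  obtain e1 e2 e3 e4 where p: "p = [e1, e2, e3, e4]"
    using assms(2) by (auto simp: numeral_eq_Suc length_Suc_conv)
  obtain u where "set p \<subseteq> parcs G" "pcas u p u" "distinct (tl (map fst p @ [snd (last p)]))"
    using assms(1) unfolding graph_cycle_iff by blast
  then show thesis
    unfolding p using that[of "fst e1" "fst e2" "fst e3" "fst e4"]
    by (cases e1; cases e2; cases e3; cases e4) auto
qed

text \<open>
  Odd lengths are excluded by parity.  In a 4-cycle one pair of opposite vertices consists of points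
  and the other of lines, so two points would lie on two common lines.
\<close>

lemma graph_cycle_length_ge_6:
  assumes disj: "P \<inter> L = {}"
    and linear: "\<And>x y l m. \<lbrakk>x \<in> P; y \<in> P; l \<in> L; m \<in> L; I x l; I y l; I x m; I y m\<rbrakk>
      \<Longrightarrow> x = y \<or> l = m"
    and cycle: "graph_cycle (incidence_graph P L I) p"
  shows "6 \<le> length p"
proof -
  obtain u where "u \<in> P \<union> L" "pcas u p u" "set p \<subseteq> parcs (incidence_graph P L I)"
    using cycle unfolding graph_cycle_iff by auto
  then have "even (length p)" using walk_parity[OF disj] by blast
  moreover have "length p \<noteq> 4"
  proof
    assume "length p = 4"
    from graph_cycle_length_4[OF cycle this] obtain u v w x where
      "(u, v) \<in> parcs (incidence_graph P L I)" "(v, w) \<in> parcs (incidence_graph P L I)"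
      "(w, x) \<in> parcs (incidence_graph P L I)" "(x, u) \<in> parcs (incidence_graph P L I)"
      "u \<noteq> w" "v \<noteq> x" by metis
    then show False
      unfolding in_parcs_incidence_graph
      using disj linear[of u w v x] linear[of v x u w] by blast
  qed
  moreover have "3 \<le> length p" using cycle by (simp add: graph_cycle_def)
  ultimately show ?thesis by presburger
qed

text \<open>A triangle of points and lines is a hexagon in the incidence graph.\<close>

lemma girth_incidence_graph_eq_6:
  assumes disj: "P \<inter> L = {}"
    and linear: "\<And>x y l m. \<lbrakk>x \<in> P; y \<in> P; l \<in> L; m \<in> L; I x l; I y l; I x m; I y m\<rbrakk>
      \<Longrightarrow> x = y \<or> l = m"
    and points: "x \<in> P" "y \<in> P" "z \<in> P" "x \<noteq> y" "y \<noteq> z" "z \<noteq> x"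
    and lines: "l \<in> L" "m \<in> L" "n \<in> L" "l \<noteq> m" "m \<noteq> n" "n \<noteq> l"
    and flags: "I x l" "I y l" "I y m" "I z m" "I z n" "I x n"
  shows "girth (incidence_graph P L I) = enat 6"
proof (rule antisym)
  let ?p = "[(x, l), (l, y), (y, m), (m, z), (z, n), (n, x)]"
  have "graph_cycle (incidence_graph P L I) ?p"
    using points lines flags disj
    by (auto simp: graph_cycle_iff in_parcs_incidence_graph)
  then have "girth (incidence_graph P L I) \<le> enat (length ?p)"
    unfolding girth_def by (intro INF_lower) simp
  then show "girth (incidence_graph P L I) \<le> enat 6"
    by (simp add: numeral_eq_Suc)
  show "enat 6 \<le> girth (incidence_graph P L I)"
    unfolding girth_def
    using graph_cycle_length_ge_6[of P L I, OF disj linear] by (intro INF_greatest) auto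
qed

section \<open>Projective planes\<close>

lemma (in projective_plane) finite_Points: "finite Points"
  and finite_Lines: "finite Lines"
  using card_Points card_Lines by (auto intro: card_ge_0_finite)

lemma (in projective_plane) linear:
  "\<lbrakk>x \<in> Points; y \<in> Points; l \<in> Lines; m \<in> Lines;
    incident x l; incident y l; incident x m; incident y m\<rbrakk> \<Longrightarrow> x = y \<or> l = m"
  using common_line by blast

lemma (in projective_plane) exists_other_point:
  assumes "l \<in> Lines"
  shows "\<exists>x\<in>Points. x \<noteq> z \<and> incident x l"
proof (rule ccontr)
  assume "\<not> ?thesis"
  then have "{x \<in> Points. incident x l} \<subseteq> {z}" by blast
  then have "card {x \<in> Points. incident x l} \<le> card {z}" by (intro card_mono) simp_all
  then show False using points_on_line[OF assms] order_ge_2 by simp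
qed

lemma card_Collect_bij_betw:
  assumes "bij_betw f A B"
  shows "card {x \<in> A. Q (f x)} = card {y \<in> B. Q y}"
proof (rule bij_betw_same_card)
  show "bij_betw f {x \<in> A. Q (f x)} {y \<in> B. Q y}"
    using assms by (auto simp: bij_betw_def inj_on_def)
qed

lemma ex1_bij_betw:
  assumes "bij_betw f A B" "\<exists>!y. y \<in> B \<and> Q y"
  shows "\<exists>!x. x \<in> A \<and> Q (f x)"
  using assms unfolding bij_betw_def inj_on_def by (metis imageE imageI)

text \<open>
  Relabelling by bijections moves the points and lines of a plane, which may have different types,
  to disjoint sets of one type; points and lines then serve together as the vertices of one graph.
\<close>

lemma projective_plane_transport:
  assumes plane: "projective_plane Points Lines incident q"
    and f: "bij_betw f P Points" and g: "bij_betw g L Lines"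
  shows "projective_plane P L (\<lambda>x l. incident (f x) (g l)) q"
proof -
  interpret projective_plane Points Lines incident q by fact
  have fP: "f x \<in> Points" if "x \<in> P" for x using f that by (auto simp: bij_betw_def)
  have gL: "g l \<in> Lines" if "l \<in> L" for l using g that by (auto simp: bij_betw_def)
  have f_inj: "f x \<noteq> f y" if "x \<in> P" "y \<in> P" "x \<noteq> y" for x y
    using f that by (auto simp: bij_betw_def inj_on_def)
  have g_inj: "g l \<noteq> g m" if "l \<in> L" "m \<in> L" "l \<noteq> m" for l m
    using g that by (auto simp: bij_betw_def inj_on_def)
  show ?thesis
  proof
    show "2 \<le> q" by (rule order_ge_2)
    show "card P = q\<^sup>2 + q + 1" "card L = q\<^sup>2 + q + 1"
      using bij_betw_same_card[OF f] bij_betw_same_card[OF g] card_Points card_Lines by simp_all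
    show "\<exists>!l. l \<in> L \<and> incident (f x) (g l) \<and> incident (f y) (g l)"
      if "x \<in> P" "y \<in> P" "x \<noteq> y" for x y
      by (rule ex1_bij_betw[OF g common_line]) (use that fP f_inj in auto)
    show "\<exists>!x. x \<in> P \<and> incident (f x) (g l) \<and> incident (f x) (g m)"
      if "l \<in> L" "m \<in> L" "l \<noteq> m" for l m
      by (rule ex1_bij_betw[OF f common_point]) (use that gL g_inj in auto)
    show "card {x \<in> P. incident (f x) (g l)} = q + 1" if "l \<in> L" for l
      using card_Collect_bij_betw[OF f, of "\<lambda>x. incident x (g l)"] points_on_line[OF gL[OF that]]
      by simp
    show "card {l \<in> L. incident (f x) (g l)} = q + 1" if "x \<in> P" for x
      using card_Collect_bij_betw[OF g, of "incident (f x)"] lines_through_point[OF fP[OF that]]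
      by simp
  qed
qed

section \<open>Pruning a projective plane\<close>

text \<open>
  The set \<open>M\<close> consists of the lines through \<open>z\<close> that are to lose a flag, and \<open>a m\<close> is the
  point that \<open>m\<close> loses.
\<close>

locale pruned_plane = projective_plane Points Lines incident q
  for Points Lines :: "'a set" and incident :: "'a \<Rightarrow> 'a \<Rightarrow> bool" and q :: nat +
  fixes infinity z :: 'a and M :: "'a set" and a :: "'a \<Rightarrow> 'a"
  assumes disjoint: "Points \<inter> Lines = {}"
    and infinity: "infinity \<in> Lines"
    and z: "z \<in> Points" "incident z infinity"
    and M: "\<And>m. m \<in> M \<Longrightarrow> m \<in> Lines \<and> m \<noteq> infinity \<and> incident z m"
    and a: "\<And>m. m \<in> M \<Longrightarrow> a m \<in> Points \<and> a m \<noteq> z \<and> incident (a m) m"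
begin

definition affine :: "'a set" where
  "affine = {x \<in> Points. \<not> incident x infinity}"

definition lines :: "'a set" where
  "lines = Lines - {infinity}"

definition inc :: "'a \<Rightarrow> 'a \<Rightarrow> bool" where
  "inc x l \<longleftrightarrow> incident x l \<and> \<not> (l \<in> M \<and> x = a l)"

definition pruned_graph :: "'a pair_pre_digraph" where
  "pruned_graph = incidence_graph (insert z affine) lines inc"

text \<open>
  The vertices that lose an edge: the lines that meet \<open>infinity\<close> in a removed point, the point
  \<open>z\<close>, and both ends of each deleted flag.
\<close>

definition low_degree :: "'a set" where
  "low_degree = {l \<in> Lines. \<not> incident z l} \<union> M \<union> {z} \<union> a ` M"

lemma disjoint_graph: "insert z affine \<inter> lines = {}"
  using disjoint z by (auto simp: affine_def lines_def)

lemma finite_graph: "finite (insert z affine)" "finite lines"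
  using finite_Points finite_Lines by (auto simp: affine_def lines_def)

lemma finite_M: "finite M"
  using finite_Lines M by (meson finite_subset subsetI)

lemma affine_point_on_line:
  assumes "l \<in> Lines" "l \<noteq> infinity" "incident z l" "x \<in> Points" "incident x l" "x \<noteq> z"
  shows "x \<in> affine"
  using assms linear[of x z l infinity] infinity z by (auto simp: affine_def)

lemma a_affine: "m \<in> M \<Longrightarrow> a m \<in> affine"
  using M a affine_point_on_line by blast

text \<open>
  Distinct lines of \<open>M\<close> meet only in \<open>z\<close>; hence the deleted flags form a matching and no
  affine point loses two lines.
\<close>

lemma inj_on_a: "inj_on a M"
proof (rule inj_onI)
  fix l m assume "l \<in> M" "m \<in> M" "a l = a m"
  then show "l = m" using linear[of "a l" z l m] M[of l] M[of m] a[of l] a[of m] z by auto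
qed

lemma card_affine: "card affine = q\<^sup>2"
proof -
  have "affine = Points - {x \<in> Points. incident x infinity}" by (auto simp: affine_def)
  then show ?thesis
    using card_Diff_subset[of "{x \<in> Points. incident x infinity}" Points]
      finite_Points points_on_line[OF infinity] card_Points by simp
qed

lemma card_lines_avoiding_z: "card {l \<in> Lines. \<not> incident z l} = q\<^sup>2"
proof -
  have "{l \<in> Lines. \<not> incident z l} = Lines - {l \<in> Lines. incident z l}" by auto
  then show ?thesis
    using card_Diff_subset[of "{l \<in> Lines. incident z l}" Lines]
      finite_Lines lines_through_point[OF z(1)] card_Lines by simp
qed

lemma card_verts: "card (pverts pruned_graph) = 2 * q\<^sup>2 + q + 1"
proof -
  have "z \<notin> affine" using z by (simp add: affine_def)
  then have "card (insert z affine) = q\<^sup>2 + 1" using finite_graph card_affine by simp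
  moreover have "card lines = q\<^sup>2 + q"
    using infinity finite_Lines card_Lines by (simp add: lines_def)
  ultimately show ?thesis
    using card_Un_disjoint[OF finite_graph disjoint_graph] by (simp add: pruned_graph_def)
qed

lemma low_degree_subset: "low_degree \<subseteq> pverts pruned_graph"
  using M a_affine z by (auto simp: low_degree_def pruned_graph_def lines_def)

lemma card_low_degree: "card low_degree = q\<^sup>2 + 1 + 2 * card M"
proof -
  have "{l \<in> Lines. \<not> incident z l} \<inter> M = {}" using M by auto
  moreover have "z \<notin> {l \<in> Lines. \<not> incident z l} \<union> M" using M z disjoint by auto
  moreover have "({l \<in> Lines. \<not> incident z l} \<union> M \<union> {z}) \<inter> a ` M = {}"
    using M a disjoint by blast
  ultimately show ?thesis
    using finite_M finite_Lines card_lines_avoiding_z card_image[OF inj_on_a]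
    by (simp add: low_degree_def card_Un_disjoint)
qed

lemma degree_line_avoiding_z:
  assumes "l \<in> Lines" "\<not> incident z l"
  shows "card {x \<in> insert z affine. inc x l} = q"
proof -
  have "l \<noteq> infinity" "l \<notin> M" using assms z M by auto
  then obtain w where w: "w \<in> Points" "incident w l" "incident w infinity"
    using common_point[OF assms(1) infinity] by blast
  have "incident x infinity \<longleftrightarrow> x = w" if "x \<in> Points" "incident x l" for x
    using linear[of x w l infinity] that w assms(1) infinity \<open>l \<noteq> infinity\<close> by blast
  then have "{x \<in> insert z affine. inc x l} = {x \<in> Points. incident x l} - {w}"
    using assms(2) \<open>l \<notin> M\<close> unfolding affine_def inc_def by blast
  then show ?thesis using w(1,2) points_on_line[OF assms(1)] finite_Points by simp
qed

lemma points_on_line_through_z: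
  assumes "l \<in> Lines" "l \<noteq> infinity" "incident z l"
  shows "{x \<in> insert z affine. incident x l} = {x \<in> Points. incident x l}"
  using affine_point_on_line[OF assms] z by (auto simp: affine_def)

lemma degree_line_through_z:
  assumes "l \<in> Lines" "l \<noteq> infinity" "incident z l"
  shows "card {x \<in> insert z affine. inc x l} = (if l \<in> M then q else q + 1)"
proof (cases "l \<in> M")
  case True
  then have "{x \<in> insert z affine. inc x l} = {x \<in> Points. incident x l} - {a l}"
    unfolding points_on_line_through_z[OF assms, symmetric] by (auto simp: inc_def)
  then show ?thesis
    using True a[OF True] points_on_line[OF assms(1)] finite_Points by simp
next
  case False
  then show ?thesis
    using points_on_line_through_z[OF assms] points_on_line[OF assms(1)] by (simp add: inc_def)
qed

lemma degree_z: "card {l \<in> lines. inc z l} = q"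
proof -
  have "{l \<in> lines. inc z l} = {l \<in> Lines. incident z l} - {infinity}"
    using a by (auto simp: lines_def inc_def)
  then show ?thesis using lines_through_point[OF z(1)] infinity z finite_Lines by simp
qed

lemma degree_affine:
  assumes "x \<in> affine"
  shows "card {l \<in> lines. inc x l} = (if x \<in> a ` M then q else q + 1)"
proof -
  have x: "x \<in> Points" "\<not> incident x infinity" using assms by (auto simp: affine_def)
  show ?thesis
  proof (cases "x \<in> a ` M")
    case True
    then obtain m where m: "m \<in> M" "x = a m" by blast
    then have "{l \<in> lines. inc x l} = {l \<in> Lines. incident x l} - {m}"
      using x inj_on_a by (auto simp: lines_def inc_def inj_on_def)
    then show ?thesis
      using True m M a lines_through_point[OF x(1)] finite_Lines by simp
  next
    case False
    then have "{l \<in> lines. inc x l} = {l \<in> Lines. incident x l}"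
      using x by (auto simp: lines_def inc_def)
    then show ?thesis using False lines_through_point[OF x(1)] by simp
  qed
qed

lemma degree_graph:
  assumes "v \<in> pverts pruned_graph"
  shows "graph_degree pruned_graph v = (if v \<in> low_degree then q else q + 1)"
proof -
  note deg = graph_degree_incidence_graph[OF disjoint_graph, where I = inc, folded pruned_graph_def]
  consider "v = z" | "v \<in> affine" | "v \<in> lines" "incident z v" | "v \<in> lines" "\<not> incident z v"
    using assms by (auto simp: pruned_graph_def)
  then show ?thesis
  proof cases
    case 1
    then show ?thesis using deg(1)[of z] degree_z by (simp add: low_degree_def)
  next
    case 2
    then have "v \<noteq> z" "v \<notin> Lines" "v \<notin> M"
      using z M disjoint by (auto simp: affine_def)
    then have "v \<in> low_degree \<longleftrightarrow> v \<in> a ` M" by (auto simp: low_degree_def)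
    then show ?thesis using 2 deg(1)[of v] degree_affine by simp
  next
    case 3
    then have "v \<in> Lines" "v \<noteq> infinity" by (auto simp: lines_def)
    moreover have "v \<in> low_degree \<longleftrightarrow> v \<in> M"
      using 3 z a disjoint \<open>v \<in> Lines\<close> by (auto simp: low_degree_def)
    ultimately show ?thesis using 3 deg(2)[of v] degree_line_through_z by simp
  next
    case 4
    then have "v \<in> Lines" "v \<in> low_degree" by (auto simp: lines_def low_degree_def)
    then show ?thesis using 4 deg(2)[of v] degree_line_avoiding_z by simp
  qed
qed

text \<open>
  The bound on \<open>card M\<close> leaves two lines \<open>m\<close> and \<open>n\<close> through \<open>z\<close>, other than
  \<open>infinity\<close>, with all their flags.  An affine point on each and the line joining the two points
  complete a triangle.  The joining line avoids \<open>z\<close>, so it is neither \<open>infinity\<close> nor in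
  \<open>M\<close>, and none of the six flags has been deleted.
\<close>

lemma girth_graph:
  assumes "card M + 2 \<le> q"
  shows "girth pruned_graph = enat 6"
proof -
  let ?F = "{l \<in> Lines. incident z l} - {infinity} - M"
  have "card ?F = q - card M"
    using lines_through_point[OF z(1)] infinity z finite_Lines finite_M M
    by (subst card_Diff_subset) auto
  then have "2 \<le> card ?F" using assms by simp
  then obtain S where S: "S \<subseteq> ?F" "card S = 2"
    by (rule obtain_subset_with_card_n)
  obtain m n where "S = {m, n}" "m \<noteq> n" using S(2) by (auto simp: card_2_iff)
  with S(1) have mn: "m \<in> ?F" "n \<in> ?F" "m \<noteq> n" by auto
  have "\<exists>x \<in> affine. incident x l" if "l \<in> ?F" for l
    using exists_other_point[of l z] affine_point_on_line[of l] that by blast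
  then obtain x y where x: "x \<in> affine" "incident x m" and y: "y \<in> affine" "incident y n"
    using mn by metis
  have Pts: "x \<in> Points" "y \<in> Points" and ne_z: "x \<noteq> z" "y \<noteq> z"
    using x y z by (auto simp: affine_def)
  have "x \<noteq> y" using linear[of x z m n] x y mn Pts ne_z z by auto
  then obtain l where l: "l \<in> Lines" "incident x l" "incident y l"
    using common_line[OF Pts] by blast
  have "l \<noteq> m" using linear[of y z m n] l y mn Pts ne_z z by auto
  have "l \<noteq> n" using linear[of x z m n] l x mn Pts ne_z z by auto
  have "\<not> incident z l" using linear[of x z m l] l x mn Pts ne_z z \<open>l \<noteq> m\<close> by auto
  then have "l \<notin> M" "l \<noteq> infinity" using M z by auto
  show ?thesis
    unfolding pruned_graph_def
  proof (rule girth_incidence_graph_eq_6[OF disjoint_graph, where x = x and y = y and z = z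
        and l = l and m = n and n = m])
    show "x' = y' \<or> l' = m'"
      if "x' \<in> insert z affine" "y' \<in> insert z affine" "l' \<in> lines" "m' \<in> lines"
        "inc x' l'" "inc y' l'" "inc x' m'" "inc y' m'" for x' y' l' m'
      using that linear[of x' y' l' m'] z by (auto simp: affine_def lines_def inc_def)
  qed (use x y l mn z ne_z \<open>x \<noteq> y\<close> \<open>l \<noteq> m\<close> \<open>l \<noteq> n\<close> \<open>l \<notin> M\<close> \<open>l \<noteq> infinity\<close>
      in \<open>auto simp: lines_def inc_def\<close>)
qed

text \<open>
  The equation makes \<open>q\<^sup>2 + 1 + 2 * card M\<close> and \<open>q\<^sup>2 + q - 2 * card M\<close> equal.  With
  \<open>2 \<le> q\<close> it also forces \<open>M\<close> to be nonempty, and then \<open>card M + 2 \<le> q\<close>, as needed for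
  the girth.
\<close>

lemma pruned_graph_is_babi:
  assumes q: "q = 4 * card M + 1"
  shows "babi_graph q (q + 1) 6 pruned_graph"
proof -
  have M_pos: "1 \<le> card M" using q order_ge_2 by simp
  have low: "{v \<in> pverts pruned_graph. graph_degree pruned_graph v = q} = low_degree"
    and high: "{v \<in> pverts pruned_graph. graph_degree pruned_graph v = q + 1} = pverts pruned_graph - low_degree"
    using low_degree_subset by (auto simp: degree_graph split: if_splits)
  have fin: "finite low_degree"
    using low_degree_subset finite_graph by (auto simp: pruned_graph_def intro: finite_subset)
  have "card (pverts pruned_graph - low_degree) = q\<^sup>2 + q - 2 * card M"
    using card_Diff_subset[OF fin low_degree_subset] card_verts card_low_degree by simp
  then have eq: "card low_degree = card (pverts pruned_graph - low_degree)"
    using q card_low_degree by simp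
  then have "card (pverts pruned_graph - low_degree) \<noteq> 0" using card_low_degree by simp
  then obtain w where "w \<in> pverts pruned_graph - low_degree" by (metis card.empty equals0I)
  moreover have "z \<in> low_degree" by (simp add: low_degree_def)
  ultimately have "graph_degree pruned_graph ` pverts pruned_graph = {q, q + 1}"
    using low_degree_subset degree_graph by (auto simp: image_iff)
  moreover have "pair_graph pruned_graph"
    unfolding pruned_graph_def by (rule pair_graph_incidence_graph[OF finite_graph disjoint_graph])
  ultimately show ?thesis
    using girth_graph q M_pos eq
    unfolding babi_graph_def babi_graph_axioms_def low high by auto
qed

end

section \<open>Existence of balanced biregular graphs\<close>

lemma exists_babi_graph:
  fixes Points Lines :: "'a set"
  assumes plane: "projective_plane Points Lines incident (4 * k + 1)"
    and disjoint: "Points \<inter> Lines = {}"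
  shows "\<exists>G :: 'a pair_pre_digraph. babi_graph (4 * k + 1) (4 * k + 1 + 1) 6 G \<and>
      card (pverts G) = 2 * (4 * k + 1)\<^sup>2 + (4 * k + 1) + 1"
proof -
  interpret projective_plane Points Lines incident "4 * k + 1" by fact
  have "Lines \<noteq> {}" using card_Lines by auto
  then obtain infinity where infinity: "infinity \<in> Lines" by blast
  have "{x \<in> Points. incident x infinity} \<noteq> {}"
    using points_on_line[OF infinity] by (metis card.empty add_is_0 one_neq_zero)
  then obtain z where z: "z \<in> Points" "incident z infinity" by blast
  have "card ({l \<in> Lines. incident z l} - {infinity}) = 4 * k + 1"
    using lines_through_point[OF z(1)] infinity z finite_Lines by simp
  then obtain M where M: "M \<subseteq> {l \<in> Lines. incident z l} - {infinity}" and card_M: "card M = k"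
    using obtain_subset_with_card_n[of k "{l \<in> Lines. incident z l} - {infinity}"] by auto
  have "\<exists>x. x \<in> Points \<and> x \<noteq> z \<and> incident x m" if "m \<in> M" for m
    using exists_other_point[of m z] that M by blast
  then obtain a where a: "\<And>m. m \<in> M \<Longrightarrow> a m \<in> Points \<and> a m \<noteq> z \<and> incident (a m) m"
    by metis
  interpret pruned_plane Points Lines incident "4 * k + 1" infinity z M a
    using disjoint infinity z M a by unfold_locales auto
  show ?thesis
    using pruned_graph_is_babi card_verts card_M by blast
qed

theorem theorem6p7:
  fixes r :: nat
    and Points :: "'p set" and Lines :: "'l set" and incident :: "'p \<Rightarrow> 'l \<Rightarrow> bool"
  assumes "2 \<le> r"
    and "[r = 1] (mod 4)"
    and "projective_plane Points Lines incident r"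
  shows "\<exists>G :: nat pair_pre_digraph.
    babi_graph r (r + 1) 6 G \<and> card (pverts G) = 2 * r\<^sup>2 + r + 1"
proof -
  interpret projective_plane Points Lines incident r by fact
  have "r mod 4 = 1" using assms(2) by (simp add: cong_def)
  then have r: "r = 4 * (r div 4) + 1" by presburger
  let ?N = "r\<^sup>2 + r + 1"
  obtain f where f: "bij_betw f {0..<?N} Points"
    using ex_bij_betw_nat_finite[OF finite_Points] card_Points by auto
  have "card {?N..<2 * ?N} = card Lines" using card_Lines by simp
  then obtain g where g: "bij_betw g {?N..<2 * ?N} Lines"
    using finite_same_card_bij[of "{?N..<2 * ?N}" Lines] finite_Lines by auto
  have "{0..<?N} \<inter> {?N..<2 * ?N} = {}" by auto
  then show ?thesis
    using exists_babi_graph[of "{0..<?N}" "{?N..<2 * ?N}" _ "r div 4", folded r,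
        OF projective_plane_transport[OF assms(3) f g]] by blast
qed

end
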